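(* In the setting and under the standing assumptions of the context (in particular (A1) and (A2)), one has $$\sup_{\xi} T(\xi) = \inf_{\theta\in\Theta}\|\eta-\eta(\cdot,\theta)\|^2,$$ where the supremum is over all designs $\xi$ on $\mathcal{X}$; that is, with $\psi(x,\theta):=\sum_{(i,j)\in\mathcal{I}}p_{i,j}\,[\eta_i(x,\rho_{(i)})-\eta_j(x,\theta_{(i,j)})]^2$, $$\sup_\xi\inf_{\theta\in\Theta}\int_{\mathcal{X}}\psi(x,\theta)\,d\xi(x)=\inf_{\theta\in\Theta}\sup_\xi\int_{\mathcal{X}}\psi(x,\theta)\,d\xi(x).$$ If the design $\xi^*$ maximizes $T(\xi)$ over all designs, then the vector $\theta^*=(\theta^*_{(i,j)})_{(i,j)\in\mathcal{I}}$ given by $\theta^*_{(i,j)}=\operatorname{argmin}_{\theta_{(j)}\in\Theta^{(j)}}\Delta_{i,j}(\theta_{(j)},\xi^* )$ satisfies $$\|\eta-\eta(\cdot,\theta^* )\|^2=\inf_{\theta\in\Theta}\|\eta-\eta(\cdot,\theta)\|^2=T(\xi^* ).$$ Moreover, the support of $\xi^*$ satisfies $$\operatorname{supp}(\xi^* )\subset\mathcal{A}:=\bigl\{x\in\mathcal{X}\ \big|\ |\eta(x)-\eta(x,\theta^* )|=\|\eta-\eta(\cdot,\theta^* )\|\bigr\}.$$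
   Context: A design is a probability measure $\xi$ with finite support on a compact design space $\mathcal{X}$. Let $\mathcal{M}=\{\eta_1,\dots,\eta_k\}$ be a class of competing real-valued regression models $\eta_j(x,\theta_{(j)})$, $x\in\mathcal{X}$, with finite-dimensional parameter $\theta_{(j)}\in\Theta^{(j)}$; they are continuous in $x$. Let $p_{i,j}\ge 0$ ($1\le i\ne j\le k$) be given weights with $\sum_{i\neq j}p_{i,j}=1$, and $\mathcal{I}=\{(i,j)\mid 1\le i\ne j\le k,\ p_{i,j}>0\}$, $d=\#\mathcal{I}$. For every $i$ occurring as a first index in $\mathcal{I}$ a parameter $\rho_{(i)}\in\Theta^{(i)}$ is fixed. For $(i,j)\in\mathcal{I}$ and a design $\xi$ put $$\Delta_{i,j}(\theta_{(j)},\xi)=\int_{\mathcal{X}}[\eta_i(x,\rho_{(i)})-\eta_j(x,\theta_{(j)})]^2\,d\xi(x),\qquad T_{i,j}(\xi)=\inf_{\theta_{(j)}\in\Theta^{(j)}}\Delta_{i,j}(\theta_{(j)},\xi),$$ $$T(\xi)=\sum_{(i,j)\in\mathcal{I}}p_{i,j}\,T_{i,j}(\xi).$$ It is assumed that the minimum defining $T_{i,j}(\xi)$ is attained. A design is called $T_p$-optimal discriminating for $\mathcal{M}$ if it maximizes $T$ over all designs. Let $\Theta=\prod_{(i,j)\in\mathcal{I}}\Theta^{(j)}$, with elements $\theta=(\theta_{(i,j)})_{(i,j)\in\mathcal{I}}$, $\theta_{(i,j)}\in\Theta^{(j)}$ (a separate parameter for each pair). Define the $\mathbb{R}^d$-valued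 functions $\eta(x)=(\eta_i(x,\rho_{(i)}))_{(i,j)\in\mathcal{I}}$ and $\eta(x,\theta)=(\eta_j(x,\theta_{(i,j)}))_{(i,j)\in\mathcal{I}}$. For $r=(r_{ij})_{(i,j)\in\mathcal{I}}\in\mathbb{R}^d$ let $|r|^2=\sum_{(i,j)\in\mathcal{I}}p_{i,j}r_{ij}^2$, and for $g\in C(\mathcal{X})^d$ let $\|g\|=\sup_{x\in\mathcal{X}}|g(x)|$. Standing assumptions: (A1) each $\eta_i(x,\theta_{(i)})$ is differentiable with respect to $\theta_{(i)}$. (A2) For a $T_p$-optimal discriminating design $\xi^*$, the parameter $\theta^*=(\theta^*_{(i,j)})_{(i,j)\in\mathcal{I}}$ with $\theta^*_{(i,j)}=\operatorname{argmin}_{\theta_{(j)}\in\Theta^{(j)}}\Delta_{i,j}(\theta_{(j)},\xi^* )$ exists, is unique, and is an interior point of $\Theta$.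
   Formalization: Added: at each optimal design, for every pair in I, some sublevel set of Delta_{i,j}(.,xi* ) strictly above its minimum is compact (without this the claim is false for non-compact Theta). Existence of a T_p-optimal design, presupposed by (A2), is made explicit. *)

theory Defs
  imports "HOL-Probability.Probability"
begin

text \<open>
  A design is a \<^typ>\<open>'x pmf\<close> with finite support contained in the design space; its
  support is \<^const>\<open>set_pmf\<close>.  The models are \<open>\<eta> 1, \<dots>, \<eta> k\<close>.  Their parameter
  vectors may have different dimensions: model \<open>j\<close> has its parameter in a subset \<open>\<Theta> j\<close> of a
  linear subspace \<open>V j\<close> of one Euclidean space \<open>'p\<close>, and \<open>V j\<close> stands for the coordinate
  space of model \<open>j\<close> (up to isomorphism, any finite list of spaces of possibly different finite
  dimensions arises in this way).
\<close>

definition designs :: "'x set \<Rightarrow> 'x pmf set" where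
  "designs X = {\<xi>. finite (set_pmf \<xi>) \<and> set_pmf \<xi> \<subseteq> X}"

definition ordered_pairs :: "nat \<Rightarrow> (nat \<times> nat) set" where
  "ordered_pairs k = {(i, j). i \<in> {1..k} \<and> j \<in> {1..k} \<and> i \<noteq> j}"

definition pairs :: "nat \<Rightarrow> (nat \<Rightarrow> nat \<Rightarrow> real) \<Rightarrow> (nat \<times> nat) set" where
  "pairs k p = {(i, j) \<in> ordered_pairs k. p i j > 0}"

definition Delta ::
  "(nat \<Rightarrow> 'x \<Rightarrow> 'p \<Rightarrow> real) \<Rightarrow> (nat \<Rightarrow> 'p) \<Rightarrow> nat \<Rightarrow> nat \<Rightarrow> 'p \<Rightarrow> 'x pmf \<Rightarrow> real" where
  "Delta \<eta> \<rho> i j \<theta> \<xi> = measure_pmf.expectation \<xi> (\<lambda>x. (\<eta> i x (\<rho> i) - \<eta> j x \<theta>)\<^sup>2)"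

definition T_pair ::
  "(nat \<Rightarrow> 'p set) \<Rightarrow> (nat \<Rightarrow> 'x \<Rightarrow> 'p \<Rightarrow> real) \<Rightarrow> (nat \<Rightarrow> 'p) \<Rightarrow> nat \<Rightarrow> nat \<Rightarrow> 'x pmf \<Rightarrow> real" where
  "T_pair \<Theta> \<eta> \<rho> i j \<xi> = (INF \<theta>\<in>\<Theta> j. Delta \<eta> \<rho> i j \<theta> \<xi>)"

definition T_crit ::
  "nat \<Rightarrow> (nat \<Rightarrow> nat \<Rightarrow> real) \<Rightarrow> (nat \<Rightarrow> 'p set) \<Rightarrow> (nat \<Rightarrow> 'x \<Rightarrow> 'p \<Rightarrow> real) \<Rightarrow> (nat \<Rightarrow> 'p)
     \<Rightarrow> 'x pmf \<Rightarrow> real" where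
  "T_crit k p \<Theta> \<eta> \<rho> \<xi> = (\<Sum>(i, j)\<in>pairs k p. p i j * T_pair \<Theta> \<eta> \<rho> i j \<xi>)"

definition Tp_optimal ::
  "'x set \<Rightarrow> nat \<Rightarrow> (nat \<Rightarrow> nat \<Rightarrow> real) \<Rightarrow> (nat \<Rightarrow> 'p set) \<Rightarrow> (nat \<Rightarrow> 'x \<Rightarrow> 'p \<Rightarrow> real)
     \<Rightarrow> (nat \<Rightarrow> 'p) \<Rightarrow> 'x pmf \<Rightarrow> bool" where
  "Tp_optimal X k p \<Theta> \<eta> \<rho> \<xi> \<longleftrightarrow>
     \<xi> \<in> designs X \<and> (\<forall>\<xi>'\<in>designs X. T_crit k p \<Theta> \<eta> \<rho> \<xi>' \<le> T_crit k p \<Theta> \<eta> \<rho> \<xi>)"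

definition param_space ::
  "nat \<Rightarrow> (nat \<Rightarrow> nat \<Rightarrow> real) \<Rightarrow> (nat \<Rightarrow> 'p set) \<Rightarrow> (nat \<times> nat \<Rightarrow> 'p) set" where
  "param_space k p \<Theta> = PiE (pairs k p) (\<lambda>ij. \<Theta> (snd ij))"

text \<open>
  The topology in which the interior of \<^term>\<open>param_space k p \<Theta>\<close> is taken: that of the
  product of the coordinate spaces \<^term>\<open>V j\<close> over all pairs.
\<close>

definition param_topology ::
  "nat \<Rightarrow> (nat \<Rightarrow> nat \<Rightarrow> real) \<Rightarrow> (nat \<Rightarrow> 'p::topological_space set)
     \<Rightarrow> (nat \<times> nat \<Rightarrow> 'p) topology" where
  "param_topology k p V = product_topology (\<lambda>ij. top_of_set (V (snd ij))) (pairs k p)"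

definition best_param ::
  "nat \<Rightarrow> (nat \<Rightarrow> nat \<Rightarrow> real) \<Rightarrow> (nat \<Rightarrow> 'p set) \<Rightarrow> (nat \<Rightarrow> 'x \<Rightarrow> 'p \<Rightarrow> real) \<Rightarrow> (nat \<Rightarrow> 'p)
     \<Rightarrow> 'x pmf \<Rightarrow> (nat \<times> nat \<Rightarrow> 'p) \<Rightarrow> bool" where
  "best_param k p \<Theta> \<eta> \<rho> \<xi> \<theta> \<longleftrightarrow>
     \<theta> \<in> param_space k p \<Theta> \<and>
     (\<forall>(i, j)\<in>pairs k p. is_arg_min (\<lambda>t. Delta \<eta> \<rho> i j t \<xi>) (\<lambda>t. t \<in> \<Theta> j) (\<theta> (i, j)))"

definition eta_vec :: "(nat \<Rightarrow> 'x \<Rightarrow> 'p \<Rightarrow> real) \<Rightarrow> (nat \<Rightarrow> 'p) \<Rightarrow> 'x \<Rightarrow> nat \<times> nat \<Rightarrow> real" where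
  "eta_vec \<eta> \<rho> x = (\<lambda>(i, j). \<eta> i x (\<rho> i))"

definition eta_param ::
  "(nat \<Rightarrow> 'x \<Rightarrow> 'p \<Rightarrow> real) \<Rightarrow> 'x \<Rightarrow> (nat \<times> nat \<Rightarrow> 'p) \<Rightarrow> nat \<times> nat \<Rightarrow> real" where
  "eta_param \<eta> x \<theta> = (\<lambda>(i, j). \<eta> j x (\<theta> (i, j)))"

definition vec_norm ::
  "nat \<Rightarrow> (nat \<Rightarrow> nat \<Rightarrow> real) \<Rightarrow> (nat \<times> nat \<Rightarrow> real) \<Rightarrow> real" where
  "vec_norm k p r = sqrt (\<Sum>(i, j)\<in>pairs k p. p i j * (r (i, j))\<^sup>2)"

definition sup_norm ::
  "'x set \<Rightarrow> nat \<Rightarrow> (nat \<Rightarrow> nat \<Rightarrow> real) \<Rightarrow> ('x \<Rightarrow> nat \<times> nat \<Rightarrow> real) \<Rightarrow> real" where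
  "sup_norm X k p g = (SUP x\<in>X. vec_norm k p (g x))"

definition residual ::
  "(nat \<Rightarrow> 'x \<Rightarrow> 'p \<Rightarrow> real) \<Rightarrow> (nat \<Rightarrow> 'p) \<Rightarrow> (nat \<times> nat \<Rightarrow> 'p) \<Rightarrow> 'x \<Rightarrow> nat \<times> nat \<Rightarrow> real" where
  "residual \<eta> \<rho> \<theta> = (\<lambda>x ij. eta_vec \<eta> \<rho> x ij - eta_param \<eta> x \<theta> ij)"

definition psi ::
  "nat \<Rightarrow> (nat \<Rightarrow> nat \<Rightarrow> real) \<Rightarrow> (nat \<Rightarrow> 'x \<Rightarrow> 'p \<Rightarrow> real) \<Rightarrow> (nat \<Rightarrow> 'p) \<Rightarrow> 'x
     \<Rightarrow> (nat \<times> nat \<Rightarrow> 'p) \<Rightarrow> real" where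
  "psi k p \<eta> \<rho> x \<theta> = (\<Sum>(i, j)\<in>pairs k p. p i j * (\<eta> i x (\<rho> i) - \<eta> j x (\<theta> (i, j)))\<^sup>2)"

text \<open>
  Some sublevel set of \<^term>\<open>\<lambda>t. Delta \<eta> \<rho> i j t \<xi>\<close> strictly above its infimum is compact,
  for every pair.  Uniqueness of the minimiser at an optimal design does not imply this: a
  minimising sequence may leave \<open>\<Theta> j\<close>, and then the minimax identity can fail.  For
  example, let the design space be \<open>{0, 1}\<close>, \<open>\<eta> 1 = 0\<close>, \<open>p 1 2 = 1\<close>, and
  \<open>\<eta> 2 0 t = r t * cos t\<close>, \<open>\<eta> 2 1 t = r t * sin t\<close> on
  \<open>\<Theta> 2 = {0..<pi/6} \<union> {1..11/10}\<close>, where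
  \<open>(r t)\<^sup>2 = 4 + (t - pi/6)\<^sup>2 * (t - pi/3)\<^sup>2\<close>.  All minima are attained, the uniform
  design is the only optimal one, with criterion value \<open>2\<close> and the single interior minimiser
  \<open>pi/3\<close>; but \<open>pi/3\<close> gives \<open>3\<close> at the point \<open>1\<close>, and every parameter gives more than
  \<open>2.8\<close> at one of the two points.  The condition holds if the sets \<open>\<Theta> j\<close> are
  compact, and also if they are closed and convex, the models are affine in the parameter, and the
  minimiser is unique.
\<close>

definition level_compact ::
  "nat \<Rightarrow> (nat \<Rightarrow> nat \<Rightarrow> real) \<Rightarrow> (nat \<Rightarrow> 'p::topological_space set)
     \<Rightarrow> (nat \<Rightarrow> 'x \<Rightarrow> 'p \<Rightarrow> real) \<Rightarrow> (nat \<Rightarrow> 'p) \<Rightarrow> 'x pmf \<Rightarrow> bool" where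
  "level_compact k p \<Theta> \<eta> \<rho> \<xi> \<longleftrightarrow>
     (\<forall>(i, j)\<in>pairs k p. \<exists>c > T_pair \<Theta> \<eta> \<rho> i j \<xi>. compact {t \<in> \<Theta> j. Delta \<eta> \<rho> i j t \<xi> \<le> c})"

end

theory Submission
  imports Defs
begin

text \<open>
  Move an optimal design \<open>\<xi>\<close> slightly towards a point \<open>x\<close>.  A minimiser for the mixture
  \<open>(1 - a) \<xi> + a \<delta>\<^sub>x\<close> nearly minimises \<open>Delta\<close> at \<open>\<xi>\<close>, so by
  compactness of a sublevel set and uniqueness of the minimiser \<open>\<theta>\<close> it tends to
  \<open>\<theta>\<close> as \<open>a\<close> tends to \<open>0\<close>.  Comparing the criterion at the mixture with its maximum
  gives \<open>psi x \<theta> \<le> T \<xi>\<close> for every \<open>x\<close>.  Since \<open>T \<xi>\<close> is the \<open>\<xi>\<close>-average of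
  \<open>psi x \<theta>\<close>, equality holds on the support, and \<open>(\<xi>, \<theta>)\<close> is a saddle point.
\<close>

section \<open>Mixing a design with a point mass\<close>

text \<open>A biased coin chooses between the point mass and \<xi>, which realises their convex
  combination. \<open>bernoulli_pmf\<close> clamps \<open>a\<close> to [0, 1], so the result is a
  distribution for every real \<open>a\<close>.\<close>

definition mix_point :: "real \<Rightarrow> 'x \<Rightarrow> 'x pmf \<Rightarrow> 'x pmf" where
  "mix_point a x \<xi> = bernoulli_pmf a \<bind> (\<lambda>b. if b then return_pmf x else \<xi>)"

lemma expectation_mix_point:
  fixes f :: "'x \<Rightarrow> real"
  assumes "finite (set_pmf \<xi>)" "0 \<le> a" "a \<le> 1"
  shows "measure_pmf.expectation (mix_point a x \<xi>) f
       = (1 - a) * measure_pmf.expectation \<xi> f + a * f x"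
proof -
  have "measure_pmf.expectation (mix_point a x \<xi>) f
      = (\<Sum>b\<in>UNIV. pmf (bernoulli_pmf a) b *\<^sub>R
            measure_pmf.expectation (if b then return_pmf x else \<xi>) f)"
    unfolding mix_point_def by (rule pmf_expectation_bind) (use assms in auto)
  then show ?thesis
    using assms by (simp add: UNIV_bool)
qed

lemma mix_point_in_designs:
  assumes "\<xi> \<in> designs X" "x \<in> X"
  shows "mix_point a x \<xi> \<in> designs X"
  using assms by (auto simp: designs_def mix_point_def split: if_splits)

lemma return_pmf_in_designs: "x \<in> X \<Longrightarrow> return_pmf x \<in> designs X"
  by (simp add: designs_def)

section \<open>Near-minimisers and a compact sublevel set\<close>

text \<open>The points of the compact sublevel set where \<open>h\<close> has dropped by at least
  \<open>e\<close> form a compact set without \<open>t0\<close>. If it is nonempty, \<open>g\<close>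
  attains a minimum on it, strictly above \<open>g t0\<close>, and this gap bounds the admissible
  \<open>d\<close>.\<close>

lemma near_minimum_lower_bound:
  fixes g h :: "'a::t2_space \<Rightarrow> real"
  assumes g: "continuous_on S g" and h: "continuous_on S h"
    and unique: "\<And>t. t \<in> S \<Longrightarrow> t \<noteq> t0 \<Longrightarrow> g t0 < g t"
    and level: "compact {t \<in> S. g t \<le> c}" and c: "g t0 < c"
    and e: "e > 0"
  shows "\<exists>d>0. \<forall>t\<in>S. g t < g t0 + d \<longrightarrow> h t0 - e < h t"
proof -
  let ?K = "{t \<in> S. g t \<le> c}"
  define B where "B = ?K \<inter> h -` {..h t0 - e}"
  have "continuous_on ?K h"
    using h by (rule continuous_on_subset) auto
  then have "closed B"
    unfolding B_def using compact_imp_closed[OF level] by (rule continuous_closed_preimage) simp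
  then have "compact (?K \<inter> B)"
    using level by (intro compact_Int_closed)
  then have B: "compact B"
    by (simp add: B_def flip: Int_assoc)
  show ?thesis
  proof (cases "B = {}")
    case True
    \<comment> \<open>Here \<open>d = c - g t0\<close> suffices, since it forces \<open>t\<close>
      into \<open>?K\<close>.\<close>
    then have "\<forall>t\<in>S. g t < g t0 + (c - g t0) \<longrightarrow> h t0 - e < h t"
      by (force simp: B_def)
    then show ?thesis using c by (intro exI[of _ "c - g t0"]) auto
  next
    case False
    have "continuous_on B g"
      using g by (rule continuous_on_subset) (auto simp: B_def)
    then obtain m where m: "m \<in> B" "\<And>t. t \<in> B \<Longrightarrow> g m \<le> g t"
      using continuous_attains_inf[OF B False] by blast
    then have "g t0 < g m"
      using e by (intro unique) (auto simp: B_def)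
    \<comment> \<open>The first entry of \<open>min\<close> puts \<open>t\<close> into
      \<open>?K\<close>; the second keeps it out of \<open>B\<close>, where \<open>g\<close> is at
      least \<open>g m\<close>.\<close>
    moreover have "h t0 - e < h t" if "t \<in> S" "g t < g t0 + min (c - g t0) (g m - g t0)" for t
      using that m(2)[of t] by (force simp: B_def not_le)
    ultimately show ?thesis using c
      by (intro exI[of _ "min (c - g t0) (g m - g t0)"]) auto
  qed
qed

section \<open>The criterion as a minimal average of \<open>psi\<close>\<close>

lemma finite_pairs: "finite (pairs k p)"
  by (rule finite_subset[of _ "{1..k} \<times> {1..k}"]) (auto simp: pairs_def ordered_pairs_def)

lemma pairsD:
  assumes "(i, j) \<in> pairs k p"
  shows "i \<in> {1..k}" "j \<in> {1..k}" "0 < p i j"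
  using assms by (auto simp: pairs_def ordered_pairs_def)

text \<open>The weights are positive on \<open>pairs\<close>, so \<open>psi\<close> is nonnegative
  and the square root can be undone. This translates between averages of \<open>psi\<close> and the
  sup norm.\<close>

lemma psi_eq_vec_norm: "psi k p \<eta> \<rho> x \<theta> = (vec_norm k p (residual \<eta> \<rho> \<theta> x))\<^sup>2"
  and vec_norm_eq_psi: "vec_norm k p (residual \<eta> \<rho> \<theta> x) = sqrt (psi k p \<eta> \<rho> x \<theta>)"
proof -
  have "0 \<le> psi k p \<eta> \<rho> x \<theta>"
    unfolding psi_def by (intro sum_nonneg) (auto dest: pairsD(3) intro: less_imp_le)
  moreover show "vec_norm k p (residual \<eta> \<rho> \<theta> x) = sqrt (psi k p \<eta> \<rho> x \<theta>)"
    by (simp add: vec_norm_def psi_def residual_def eta_vec_def eta_param_def)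
  ultimately show "psi k p \<eta> \<rho> x \<theta> = (vec_norm k p (residual \<eta> \<rho> \<theta> x))\<^sup>2"
    by simp
qed

text \<open>As a finite sum, \<open>Delta\<close> inherits continuity in the parameter from the
  models.\<close>

lemma Delta_eq_sum:
  assumes "finite (set_pmf \<xi>)"
  shows "Delta \<eta> \<rho> i j t \<xi> = (\<Sum>x\<in>set_pmf \<xi>. pmf \<xi> x * (\<eta> i x (\<rho> i) - \<eta> j x t)\<^sup>2)"
  unfolding Delta_def by (subst integral_measure_pmf[OF assms]) auto

lemma Delta_mix_point:
  assumes "finite (set_pmf \<xi>)" "0 \<le> a" "a \<le> 1"
  shows "Delta \<eta> \<rho> i j t (mix_point a x \<xi>)
       = (1 - a) * Delta \<eta> \<rho> i j t \<xi> + a * (\<eta> i x (\<rho> i) - \<eta> j x t)\<^sup>2"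
  unfolding Delta_def using assms by (rule expectation_mix_point)

lemma Delta_nonneg: "0 \<le> Delta \<eta> \<rho> i j t \<xi>"
  by (simp add: Delta_def)

text \<open>The integrand is a square, so 0 is the lower bound that the conditionally complete
  \<open>INF\<close> requires.\<close>

lemma T_pair_le: "t \<in> \<Theta> j \<Longrightarrow> T_pair \<Theta> \<eta> \<rho> i j \<xi> \<le> Delta \<eta> \<rho> i j t \<xi>"
  unfolding T_pair_def by (rule cINF_lower) (auto intro!: bdd_belowI[of _ 0] Delta_nonneg)

lemma T_pair_eq:
  assumes "is_arg_min (\<lambda>t. Delta \<eta> \<rho> i j t \<xi>) (\<lambda>t. t \<in> \<Theta> j) t"
  shows "T_pair \<Theta> \<eta> \<rho> i j \<xi> = Delta \<eta> \<rho> i j t \<xi>"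
  unfolding T_pair_def
  by (rule cInf_eq_minimum) (use assms in \<open>auto simp: is_arg_min_linorder\<close>)

lemma expectation_psi:
  assumes "finite (set_pmf \<xi>)"
  shows "measure_pmf.expectation \<xi> (\<lambda>x. psi k p \<eta> \<rho> x \<theta>)
       = (\<Sum>(i, j)\<in>pairs k p. p i j * Delta \<eta> \<rho> i j (\<theta> (i, j)) \<xi>)"
  unfolding psi_def Delta_def split_beta
  by (subst Bochner_Integration.integral_sum) (auto intro: integrable_measure_pmf_finite assms)

lemma T_crit_le_expectation_psi:
  assumes "finite (set_pmf \<xi>)" "\<theta> \<in> param_space k p \<Theta>"
  shows "T_crit k p \<Theta> \<eta> \<rho> \<xi> \<le> measure_pmf.expectation \<xi> (\<lambda>x. psi k p \<eta> \<rho> x \<theta>)"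
  unfolding expectation_psi[OF assms(1)] T_crit_def
proof (intro sum_mono, clarify)
  fix i j assume ij: "(i, j) \<in> pairs k p"
  then have "\<theta> (i, j) \<in> \<Theta> j"
    using assms(2) by (auto simp: param_space_def dest: PiE_mem)
  then show "p i j * T_pair \<Theta> \<eta> \<rho> i j \<xi> \<le> p i j * Delta \<eta> \<rho> i j (\<theta> (i, j)) \<xi>"
    using pairsD(3)[OF ij] by (simp add: T_pair_le)
qed

lemma T_crit_eq_expectation_psi:
  assumes "finite (set_pmf \<xi>)" "best_param k p \<Theta> \<eta> \<rho> \<xi> \<theta>"
  shows "T_crit k p \<Theta> \<eta> \<rho> \<xi> = measure_pmf.expectation \<xi> (\<lambda>x. psi k p \<eta> \<rho> x \<theta>)"
  unfolding expectation_psi[OF assms(1)] T_crit_def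
  by (rule sum.cong) (use assms(2) in \<open>auto simp: best_param_def T_pair_eq\<close>)

text \<open>A vector in \<open>param_space\<close> has a separate coordinate for every pair, so
  minimising the weighted sum amounts to minimising each \<open>Delta\<close> on its own; the
  pairwise minimisers attain the bound together.\<close>

lemma INF_expectation_psi:
  assumes "finite (set_pmf \<xi>)" "best_param k p \<Theta> \<eta> \<rho> \<xi> \<theta>"
  shows "(INF \<theta>\<in>param_space k p \<Theta>. measure_pmf.expectation \<xi> (\<lambda>x. psi k p \<eta> \<rho> x \<theta>))
       = T_crit k p \<Theta> \<eta> \<rho> \<xi>"
proof (rule cInf_eq_minimum)
  have "\<theta> \<in> param_space k p \<Theta>"
    using assms(2) by (simp add: best_param_def)
  then show "T_crit k p \<Theta> \<eta> \<rho> \<xi>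
      \<in> (\<lambda>\<theta>. measure_pmf.expectation \<xi> (\<lambda>x. psi k p \<eta> \<rho> x \<theta>)) ` param_space k p \<Theta>"
    using T_crit_eq_expectation_psi[OF assms] by blast
qed (use T_crit_le_expectation_psi[OF assms(1)] in blast)

lemma best_param_exists:
  assumes "\<forall>(i, j)\<in>pairs k p. \<exists>t. is_arg_min (\<lambda>t. Delta \<eta> \<rho> i j t \<xi>) (\<lambda>t. t \<in> \<Theta> j) t"
  shows "\<exists>\<theta>. best_param k p \<Theta> \<eta> \<rho> \<xi> \<theta>"
proof -
  from assms obtain \<theta> where \<theta>: "\<And>i j. (i, j) \<in> pairs k p \<Longrightarrow>
      is_arg_min (\<lambda>t. Delta \<eta> \<rho> i j t \<xi>) (\<lambda>t. t \<in> \<Theta> j) (\<theta> (i, j))"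
    using bchoice[of "pairs k p" "\<lambda>(i, j) t. is_arg_min (\<lambda>t. Delta \<eta> \<rho> i j t \<xi>) (\<lambda>t. t \<in> \<Theta> j) t"]
    by fastforce
  \<comment> \<open>Restriction is needed because \<open>PiE\<close> fixes the values outside
    \<open>pairs k p\<close>.\<close>
  then have "best_param k p \<Theta> \<eta> \<rho> \<xi> (restrict \<theta> (pairs k p))"
    by (auto simp: best_param_def param_space_def is_arg_min_def)
  then show ?thesis by blast
qed

section \<open>Moving an optimal design towards a point\<close>

text \<open>Another minimiser for a single pair could replace that one coordinate of \<theta>,
  giving a second best vector.\<close>

lemma unique_best_param_less:
  assumes unique: "\<exists>!\<theta>. best_param k p \<Theta> \<eta> \<rho> \<xi> \<theta>"
    and best: "best_param k p \<Theta> \<eta> \<rho> \<xi> \<theta>"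
    and ij: "(i, j) \<in> pairs k p" and t: "t \<in> \<Theta> j" "t \<noteq> \<theta> (i, j)"
  shows "Delta \<eta> \<rho> i j (\<theta> (i, j)) \<xi> < Delta \<eta> \<rho> i j t \<xi>"
proof (rule ccontr)
  assume "\<not> ?thesis"
  moreover have "is_arg_min (\<lambda>t. Delta \<eta> \<rho> i j t \<xi>) (\<lambda>t. t \<in> \<Theta> j) (\<theta> (i, j))"
    using best ij by (auto simp: best_param_def)
  ultimately have "is_arg_min (\<lambda>t. Delta \<eta> \<rho> i j t \<xi>) (\<lambda>t. t \<in> \<Theta> j) t"
    using t(1) unfolding is_arg_min_linorder by force
  then have "best_param k p \<Theta> \<eta> \<rho> \<xi> (\<theta>((i, j) := t))"
    using best ij t(1) by (auto simp: best_param_def param_space_def PiE_iff extensional_def)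
  then have "\<theta>((i, j) := t) = \<theta>"
    using unique best by blast
  then show False
    using t(2) by (metis fun_upd_same)
qed

text \<open>A minimiser for the mixture nearly minimises \<open>Delta\<close> at \<xi> once
  \<open>a\<close> is small, so its squared residual at \<open>x\<close> is at least that of
  \<open>t0\<close> up to \<open>e\<close>. This is a first-order lower bound along the segment from
  \<xi> to the point mass.\<close>

lemma T_pair_mix_point_lower_bound:
  fixes \<Theta> :: "nat \<Rightarrow> 'p::t2_space set"
  assumes \<xi>: "finite (set_pmf \<xi>)"
    and attained: "\<And>a. \<exists>t. is_arg_min (\<lambda>t. Delta \<eta> \<rho> i j t (mix_point a x \<xi>)) (\<lambda>t. t \<in> \<Theta> j) t"
    and cont: "\<And>y. y \<in> insert x (set_pmf \<xi>) \<Longrightarrow> continuous_on (\<Theta> j) (\<eta> j y)"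
    and t0: "t0 \<in> \<Theta> j"
    and unique: "\<And>t. t \<in> \<Theta> j \<Longrightarrow> t \<noteq> t0 \<Longrightarrow> Delta \<eta> \<rho> i j t0 \<xi> < Delta \<eta> \<rho> i j t \<xi>"
    and level: "compact {t \<in> \<Theta> j. Delta \<eta> \<rho> i j t \<xi> \<le> c}" and c: "Delta \<eta> \<rho> i j t0 \<xi> < c"
    and e: "e > 0"
  shows "\<forall>\<^sub>F a in at_right 0. (1 - a) * Delta \<eta> \<rho> i j t0 \<xi> + a * ((\<eta> i x (\<rho> i) - \<eta> j x t0)\<^sup>2 - e)
           \<le> T_pair \<Theta> \<eta> \<rho> i j (mix_point a x \<xi>)"
proof -
  let ?g = "\<lambda>t. Delta \<eta> \<rho> i j t \<xi>" and ?h = "\<lambda>t. (\<eta> i x (\<rho> i) - \<eta> j x t)\<^sup>2"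
  have "continuous_on (\<Theta> j) ?g"
    unfolding Delta_eq_sum[OF \<xi>] using cont by (intro continuous_intros) auto
  moreover have "continuous_on (\<Theta> j) ?h"
    using cont by (intro continuous_intros) auto
  ultimately obtain d where d: "d > 0"
      "\<And>t. t \<in> \<Theta> j \<Longrightarrow> ?g t < ?g t0 + d \<Longrightarrow> ?h t0 - e < ?h t"
    using near_minimum_lower_bound[OF _ _ unique level c e, of ?h] by blast
  \<comment> \<open>The limit is \<open>- d\<close>, so for small \<open>a\<close> the cost
    \<open>a * ?h t0\<close> of using \<open>t0\<close> is below \<open>(1 - a) * d\<close>.\<close>
  have "((\<lambda>a. a * ?h t0 - (1 - a) * d) \<longlongrightarrow> 0 * ?h t0 - (1 - 0) * d) (at_right 0)"
    by (intro tendsto_intros)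
  then have "\<forall>\<^sub>F a in at_right 0. a * ?h t0 - (1 - a) * d < 0"
    by (rule order_tendstoD) (use d(1) in simp)
  moreover have "\<forall>\<^sub>F a::real in at_right 0. a \<in> {0<..<1}"
    by (rule eventually_at_right_real) simp
  ultimately show ?thesis
  proof eventually_elim
    case (elim a)
    then have a: "0 < a" "a < 1" by auto
    note mix = Delta_mix_point[OF \<xi> less_imp_le[OF a(1)] less_imp_le[OF a(2)]]
    obtain t where t: "is_arg_min (\<lambda>t. Delta \<eta> \<rho> i j t (mix_point a x \<xi>)) (\<lambda>t. t \<in> \<Theta> j) t"
      using attained by blast
    then have t_in: "t \<in> \<Theta> j" by (simp add: is_arg_min_def)
    \<comment> \<open>\<open>t\<close> does at least as well as \<open>t0\<close> at the mixture;
      dropping the nonnegative term \<open>a * ?h t\<close> shows that \<open>t\<close> is within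
      \<open>d\<close> of the minimum of \<open>?g\<close>.\<close>
    have "(1 - a) * ?g t + a * ?h t \<le> (1 - a) * ?g t0 + a * ?h t0"
      using t t0 by (simp add: is_arg_min_linorder mix)
    moreover have "0 \<le> a * ?h t"
      using a by simp
    ultimately have "(1 - a) * ?g t < (1 - a) * (?g t0 + d)"
      using elim(1) by (simp add: distrib_left)
    then have "?g t < ?g t0 + d"
      using a by simp
    then have "?h t0 - e \<le> ?h t"
      using d(2) t_in by force
    moreover have "?g t0 \<le> ?g t"
      using unique[OF t_in] by (cases "t = t0") auto
    ultimately have "(1 - a) * ?g t0 + a * (?h t0 - e) \<le> (1 - a) * ?g t + a * ?h t"
      using a by (intro add_mono mult_left_mono) auto
    then show ?case
      by (simp add: T_pair_eq[of \<eta> \<rho> i j _ \<Theta> t, OF t] mix)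
  qed
qed

text \<open>The weighted sum of the pairwise bounds is at most the criterion at the mixture, hence
  at most its value at \<xi>. Cancelling the common part and dividing by \<open>a\<close> leaves the
  claim up to a multiple of \<open>e\<close>.\<close>

lemma psi_le_T_crit_optimal:
  fixes \<Theta> :: "nat \<Rightarrow> 'p::t2_space set"
  assumes opt: "Tp_optimal X k p \<Theta> \<eta> \<rho> \<xi>"
    and best: "best_param k p \<Theta> \<eta> \<rho> \<xi> \<theta>"
    and unique: "\<exists>!\<theta>. best_param k p \<Theta> \<eta> \<rho> \<xi> \<theta>"
    and level: "level_compact k p \<Theta> \<eta> \<rho> \<xi>"
    and attained: "\<forall>\<xi>\<in>designs X. \<forall>(i, j)\<in>pairs k p.
        \<exists>t. is_arg_min (\<lambda>t. Delta \<eta> \<rho> i j t \<xi>) (\<lambda>t. t \<in> \<Theta> j) t"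
    and cont: "\<forall>j\<in>{1..k}. \<forall>x\<in>X. continuous_on (\<Theta> j) (\<eta> j x)"
    and x: "x \<in> X"
  shows "psi k p \<eta> \<rho> x \<theta> \<le> T_crit k p \<Theta> \<eta> \<rho> \<xi>"
proof -
  let ?I = "pairs k p" and ?T = "T_crit k p \<Theta> \<eta> \<rho>"
  let ?P = "\<Sum>(i, j)\<in>?I. p i j"
  let ?h = "\<lambda>i j. (\<eta> i x (\<rho> i) - \<eta> j x (\<theta> (i, j)))\<^sup>2"
  have \<xi>: "\<xi> \<in> designs X" "finite (set_pmf \<xi>)" "set_pmf \<xi> \<subseteq> X"
    using opt by (auto simp: Tp_optimal_def designs_def)
  \<comment> \<open>Each pair loses \<open>e\<close>, so the total loss is \<open>e\<close> times
    the sum \<open>?P\<close> of the weights.\<close>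
  have bound: "psi k p \<eta> \<rho> x \<theta> \<le> ?T \<xi> + e * ?P" if e: "e > 0" for e
  proof -
    have "\<forall>ij\<in>?I. \<forall>\<^sub>F a in at_right 0.
        (1 - a) * T_pair \<Theta> \<eta> \<rho> (fst ij) (snd ij) \<xi> + a * (?h (fst ij) (snd ij) - e)
          \<le> T_pair \<Theta> \<eta> \<rho> (fst ij) (snd ij) (mix_point a x \<xi>)"
    proof
      fix ij assume "ij \<in> ?I"
      then obtain i j where ij: "ij = (i, j)" "(i, j) \<in> ?I" by (cases ij) auto
      have min: "is_arg_min (\<lambda>t. Delta \<eta> \<rho> i j t \<xi>) (\<lambda>t. t \<in> \<Theta> j) (\<theta> (i, j))"
        using best ij by (auto simp: best_param_def)
      obtain c where "compact {t \<in> \<Theta> j. Delta \<eta> \<rho> i j t \<xi> \<le> c}" "T_pair \<Theta> \<eta> \<rho> i j \<xi> < c"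
        using level ij unfolding level_compact_def by blast
      then have c: "Delta \<eta> \<rho> i j (\<theta> (i, j)) \<xi> < c" "compact {t \<in> \<Theta> j. Delta \<eta> \<rho> i j t \<xi> \<le> c}"
        by (simp_all add: T_pair_eq[of \<eta> \<rho> i j \<xi> \<Theta>, OF min])
      have "\<exists>t. is_arg_min (\<lambda>t. Delta \<eta> \<rho> i j t (mix_point a x \<xi>)) (\<lambda>t. t \<in> \<Theta> j) t" for a
        using attained mix_point_in_designs[OF \<xi>(1) x] ij(2) by blast
      moreover have "continuous_on (\<Theta> j) (\<eta> j y)" if "y \<in> insert x (set_pmf \<xi>)" for y
        using cont x \<xi>(3) pairsD(2)[OF ij(2)] that by blast
      moreover have "\<theta> (i, j) \<in> \<Theta> j"
        using min by (simp add: is_arg_min_def)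
      ultimately have "\<forall>\<^sub>F a in at_right 0.
        (1 - a) * Delta \<eta> \<rho> i j (\<theta> (i, j)) \<xi> + a * (?h i j - e)
          \<le> T_pair \<Theta> \<eta> \<rho> i j (mix_point a x \<xi>)"
        by (rule T_pair_mix_point_lower_bound[of \<xi> \<eta> \<rho> i j x \<Theta>, OF \<xi>(2) _ _ _
              unique_best_param_less[OF unique best ij(2)] c(2) c(1) e])
      then show "\<forall>\<^sub>F a in at_right 0.
        (1 - a) * T_pair \<Theta> \<eta> \<rho> (fst ij) (snd ij) \<xi> + a * (?h (fst ij) (snd ij) - e)
          \<le> T_pair \<Theta> \<eta> \<rho> (fst ij) (snd ij) (mix_point a x \<xi>)"
        unfolding ij(1) fst_conv snd_conv T_pair_eq[of \<eta> \<rho> i j \<xi> \<Theta>, OF min] .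
    qed
    \<comment> \<open>There are finitely many pairs, so one range of small \<open>a\<close> serves
      all of them.\<close>
    then have "\<forall>\<^sub>F a in at_right 0. \<forall>ij\<in>?I.
        (1 - a) * T_pair \<Theta> \<eta> \<rho> (fst ij) (snd ij) \<xi> + a * (?h (fst ij) (snd ij) - e)
          \<le> T_pair \<Theta> \<eta> \<rho> (fst ij) (snd ij) (mix_point a x \<xi>)"
      by (simp add: eventually_ball_finite_distrib finite_pairs)
    then have "\<forall>\<^sub>F a in at_right (0::real). psi k p \<eta> \<rho> x \<theta> \<le> ?T \<xi> + e * ?P"
      using eventually_at_right_less
    proof eventually_elim
      case (elim a)
      have "(1 - a) * ?T \<xi> + a * (psi k p \<eta> \<rho> x \<theta> - e * ?P)
          = (\<Sum>(i, j)\<in>?I. p i j * ((1 - a) * T_pair \<Theta> \<eta> \<rho> i j \<xi> + a * (?h i j - e)))"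
        unfolding T_crit_def psi_def split_beta
        by (simp add: algebra_simps sum.distrib sum_subtractf sum_distrib_left)
      also have "\<dots> \<le> ?T (mix_point a x \<xi>)"
        unfolding T_crit_def
      proof (intro sum_mono, clarify)
        fix i j assume ij: "(i, j) \<in> ?I"
        show "p i j * ((1 - a) * T_pair \<Theta> \<eta> \<rho> i j \<xi> + a * (?h i j - e))
            \<le> p i j * T_pair \<Theta> \<eta> \<rho> i j (mix_point a x \<xi>)"
          using bspec[OF elim(1) ij] pairsD(3)[OF ij] by (intro mult_left_mono) auto
      qed
      also have "\<dots> \<le> ?T \<xi>"
        using opt mix_point_in_designs[OF \<xi>(1) x] by (auto simp: Tp_optimal_def)
      finally have "a * (psi k p \<eta> \<rho> x \<theta> - e * ?P) \<le> a * ?T \<xi>"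
        by (simp add: algebra_simps)
      then show ?case
        using elim(2) by simp
    qed
    \<comment> \<open>The inequality does not involve \<open>a\<close>, and
      \<open>at_right 0\<close> is a nontrivial filter.\<close>
    then show ?thesis by simp
  qed
  have "0 \<le> ?P"
    by (intro sum_nonneg) (auto dest: pairsD(3) intro: less_imp_le)
  show ?thesis
  proof (rule field_le_epsilon)
    fix e :: real assume e: "e > 0"
    \<comment> \<open>Adding 1 keeps the denominator positive, and \<open>?P / (?P + 1)\<close> is
      at most 1.\<close>
    have "e / (?P + 1) * ?P \<le> e"
      using e \<open>0 \<le> ?P\<close> by (simp add: field_simps)
    then show "psi k p \<eta> \<rho> x \<theta> \<le> ?T \<xi> + e"
      using bound[of "e / (?P + 1)"] e \<open>0 \<le> ?P\<close> by auto
  qed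
qed

section \<open>Averages of \<open>psi\<close> and the sup norm\<close>

lemma continuous_on_psi:
  assumes "\<forall>j\<in>{1..k}. \<forall>t\<in>\<Theta> j. continuous_on X (\<lambda>x. \<eta> j x t)"
    and "\<forall>(i, j)\<in>pairs k p. \<rho> i \<in> \<Theta> i"
    and "\<theta> \<in> param_space k p \<Theta>"
  shows "continuous_on X (\<lambda>x. psi k p \<eta> \<rho> x \<theta>)"
  unfolding psi_def split_beta
proof (intro continuous_intros)
  fix ij assume "ij \<in> pairs k p"
  then have ij: "(fst ij, snd ij) \<in> pairs k p" by simp
  show "continuous_on X (\<lambda>x. \<eta> (fst ij) x (\<rho> (fst ij)))"
    using assms(1,2) ij pairsD[OF ij] by fast
  have "\<theta> (fst ij, snd ij) \<in> \<Theta> (snd ij)"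
    using assms(3) ij unfolding param_space_def by (metis PiE_mem snd_conv)
  then show "continuous_on X (\<lambda>x. \<eta> (snd ij) x (\<theta> (fst ij, snd ij)))"
    using assms(1) pairsD[OF ij] by blast
qed

lemma expectation_le_bound:
  fixes f :: "'x \<Rightarrow> real"
  assumes "\<xi> \<in> designs X" "\<And>x. x \<in> X \<Longrightarrow> f x \<le> c"
  shows "measure_pmf.expectation \<xi> f \<le> c"
  using assms
  by (intro measure_pmf.integral_le_const integrable_measure_pmf_finite)
     (auto simp: designs_def AE_measure_pmf_iff)

text \<open>The nonnegative function \<open>c - f x\<close> has integral 0, so it vanishes almost
  everywhere, which for a \<open>pmf\<close> means on the whole support.\<close>

lemma expectation_eq_bound_imp_eq:
  fixes f :: "'x \<Rightarrow> real"
  assumes fin: "finite (set_pmf \<xi>)" and le: "\<And>x. x \<in> set_pmf \<xi> \<Longrightarrow> f x \<le> c"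
    and eq: "measure_pmf.expectation \<xi> f = c" and x: "x \<in> set_pmf \<xi>"
  shows "f x = c"
proof -
  have int: "integrable (measure_pmf \<xi>) f"
    using fin by (rule integrable_measure_pmf_finite)
  have "measure_pmf.expectation \<xi> (\<lambda>x. c - f x) = 0"
    using eq int by simp
  moreover have "AE x in measure_pmf \<xi>. 0 \<le> c - f x"
    using le by (simp add: AE_measure_pmf_iff)
  ultimately have "AE x in measure_pmf \<xi>. c - f x = 0"
    using integral_nonneg_eq_0_iff_AE[of "measure_pmf \<xi>" "\<lambda>x. c - f x"] int by simp
  then show ?thesis
    using x by (simp add: AE_measure_pmf_iff)
qed

text \<open>Everything is read off at a maximum point \<open>m\<close> of \<open>psi\<close>: the
  square root is monotone, so \<open>m\<close> also realises the sup norm, and no design average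
  exceeds the value at \<open>m\<close>.\<close>

lemma
  fixes X :: "'x::topological_space set"
  assumes X: "compact X" "X \<noteq> {}" and cont: "continuous_on X (\<lambda>x. psi k p \<eta> \<rho> x \<theta>)"
  shows psi_le_sup_norm: "x \<in> X \<Longrightarrow> psi k p \<eta> \<rho> x \<theta> \<le> (sup_norm X k p (residual \<eta> \<rho> \<theta>))\<^sup>2"
    and sup_norm_attained: "\<exists>x\<in>X. vec_norm k p (residual \<eta> \<rho> \<theta> x) = sup_norm X k p (residual \<eta> \<rho> \<theta>)"
    and SUP_expectation_psi: "(SUP \<xi>\<in>designs X. measure_pmf.expectation \<xi> (\<lambda>x. psi k p \<eta> \<rho> x \<theta>))
          = (sup_norm X k p (residual \<eta> \<rho> \<theta>))\<^sup>2"
proof -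
  obtain m where m: "m \<in> X" "\<And>x. x \<in> X \<Longrightarrow> psi k p \<eta> \<rho> x \<theta> \<le> psi k p \<eta> \<rho> m \<theta>"
    using continuous_attains_sup[OF X cont] by blast
  have sup: "sup_norm X k p (residual \<eta> \<rho> \<theta>) = vec_norm k p (residual \<eta> \<rho> \<theta> m)"
    unfolding sup_norm_def
    by (rule cSup_eq_maximum) (use m in \<open>auto simp: vec_norm_eq_psi\<close>)
  then show "\<exists>x\<in>X. vec_norm k p (residual \<eta> \<rho> \<theta> x) = sup_norm X k p (residual \<eta> \<rho> \<theta>)"
    using m(1) by metis
  show "psi k p \<eta> \<rho> x \<theta> \<le> (sup_norm X k p (residual \<eta> \<rho> \<theta>))\<^sup>2" if "x \<in> X"
    using m(2)[OF that] by (simp add: sup flip: psi_eq_vec_norm)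
  \<comment> \<open>The point mass at \<open>m\<close> is a design attaining the supremum.\<close>
  have "psi k p \<eta> \<rho> m \<theta> = measure_pmf.expectation (return_pmf m) (\<lambda>x. psi k p \<eta> \<rho> x \<theta>)"
    by simp
  then show "(SUP \<xi>\<in>designs X. measure_pmf.expectation \<xi> (\<lambda>x. psi k p \<eta> \<rho> x \<theta>))
          = (sup_norm X k p (residual \<eta> \<rho> \<theta>))\<^sup>2"
    unfolding sup psi_eq_vec_norm[symmetric]
    by (intro cSup_eq_maximum)
       (use m return_pmf_in_designs[OF m(1)] in \<open>blast intro: expectation_le_bound\<close>)+
qed

section \<open>Saddle point, minimax identity and support\<close>

theorem theorem3p2:
  fixes X :: "'x::t2_space set"
    and k :: nat
    and p :: "nat \<Rightarrow> nat \<Rightarrow> real"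
    and V \<Theta> :: "nat \<Rightarrow> 'p::euclidean_space set"
    and \<eta> :: "nat \<Rightarrow> 'x \<Rightarrow> 'p \<Rightarrow> real"
    and \<rho> :: "nat \<Rightarrow> 'p"
  assumes compact_X: "compact X"
    and weights_nonneg: "\<forall>(i, j)\<in>ordered_pairs k. p i j \<ge> 0"
    and weights_sum: "(\<Sum>(i, j)\<in>ordered_pairs k. p i j) = 1"
    and parameter_sets: "\<forall>j\<in>{1..k}. subspace (V j) \<and> \<Theta> j \<subseteq> V j"
    and rho_mem: "\<forall>(i, j)\<in>pairs k p. \<rho> i \<in> \<Theta> i"
    and model_continuous: "\<forall>j\<in>{1..k}. \<forall>t\<in>\<Theta> j. continuous_on X (\<lambda>x. \<eta> j x t)"
    and min_attained: "\<forall>\<xi>\<in>designs X. \<forall>(i, j)\<in>pairs k p.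
        \<exists>t. is_arg_min (\<lambda>t. Delta \<eta> \<rho> i j t \<xi>) (\<lambda>t. t \<in> \<Theta> j) t"
    and A1: "\<forall>j\<in>{1..k}. \<forall>x\<in>X. (\<lambda>t. \<eta> j x t) differentiable_on \<Theta> j"
    and A2_existence: "\<exists>\<xi>. Tp_optimal X k p \<Theta> \<eta> \<rho> \<xi>"
    and A2: "\<forall>\<xi>. Tp_optimal X k p \<Theta> \<eta> \<rho> \<xi> \<longrightarrow>
        (\<exists>!\<theta>. best_param k p \<Theta> \<eta> \<rho> \<xi> \<theta>) \<and>
        (\<forall>\<theta>. best_param k p \<Theta> \<eta> \<rho> \<xi> \<theta> \<longrightarrow>
             \<theta> \<in> param_topology k p V interior_of param_space k p \<Theta>)"
    and level: "\<forall>\<xi>. Tp_optimal X k p \<Theta> \<eta> \<rho> \<xi> \<longrightarrow> level_compact k p \<Theta> \<eta> \<rho> \<xi>"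
  shows "(SUP \<xi>\<in>designs X. T_crit k p \<Theta> \<eta> \<rho> \<xi>)
           = (INF \<theta>\<in>param_space k p \<Theta>. (sup_norm X k p (residual \<eta> \<rho> \<theta>))\<^sup>2)
       \<and> (SUP \<xi>\<in>designs X. INF \<theta>\<in>param_space k p \<Theta>.
             measure_pmf.expectation \<xi> (\<lambda>x. psi k p \<eta> \<rho> x \<theta>))
           = (INF \<theta>\<in>param_space k p \<Theta>. SUP \<xi>\<in>designs X.
             measure_pmf.expectation \<xi> (\<lambda>x. psi k p \<eta> \<rho> x \<theta>))
       \<and> (\<forall>\<xi> \<theta>. Tp_optimal X k p \<Theta> \<eta> \<rho> \<xi> \<longrightarrow> best_param k p \<Theta> \<eta> \<rho> \<xi> \<theta> \<longrightarrow>
             (sup_norm X k p (residual \<eta> \<rho> \<theta>))\<^sup>2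
               = (INF \<theta>'\<in>param_space k p \<Theta>. (sup_norm X k p (residual \<eta> \<rho> \<theta>'))\<^sup>2)
           \<and> (INF \<theta>'\<in>param_space k p \<Theta>. (sup_norm X k p (residual \<eta> \<rho> \<theta>'))\<^sup>2)
               = T_crit k p \<Theta> \<eta> \<rho> \<xi>
           \<and> set_pmf \<xi> \<subseteq> {x \<in> X. vec_norm k p (residual \<eta> \<rho> \<theta> x)
                                 = sup_norm X k p (residual \<eta> \<rho> \<theta>)})"
proof -
  let ?S = "\<lambda>\<theta>. (sup_norm X k p (residual \<eta> \<rho> \<theta>))\<^sup>2"
  let ?T = "T_crit k p \<Theta> \<eta> \<rho>" and ?\<Theta> = "param_space k p \<Theta>"
  let ?E = "\<lambda>\<xi> \<theta>. measure_pmf.expectation \<xi> (\<lambda>x. psi k p \<eta> \<rho> x \<theta>)"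
  \<comment> \<open>An optimal design has nonempty support inside \<open>X\<close>.\<close>
  have X: "X \<noteq> {}"
    using A2_existence set_pmf_not_empty by (fastforce simp: Tp_optimal_def designs_def)
  have cont: "\<forall>j\<in>{1..k}. \<forall>x\<in>X. continuous_on (\<Theta> j) (\<eta> j x)"
    using A1 differentiable_imp_continuous_on by blast
  have cont_psi: "continuous_on X (\<lambda>x. psi k p \<eta> \<rho> x \<theta>)" if "\<theta> \<in> ?\<Theta>" for \<theta>
    using model_continuous rho_mem that by (rule continuous_on_psi)
  \<comment> \<open>Weak duality: the average of \<open>psi\<close> lies between the two
    sides.\<close>
  have lower: "?T \<xi> \<le> ?S \<theta>" if "\<xi> \<in> designs X" "\<theta> \<in> ?\<Theta>" for \<xi> \<theta>
  proof -
    have "?T \<xi> \<le> ?E \<xi> \<theta>"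
      using that by (intro T_crit_le_expectation_psi) (auto simp: designs_def)
    also have "\<dots> \<le> ?S \<theta>"
      using that(1) psi_le_sup_norm[OF compact_X X cont_psi[OF that(2)]]
      by (rule expectation_le_bound)
    finally show ?thesis .
  qed
  have saddle: "?S \<theta> = ?T \<xi> \<and> (INF \<theta>\<in>?\<Theta>. ?S \<theta>) = ?T \<xi> \<and>
      set_pmf \<xi> \<subseteq> {x \<in> X. vec_norm k p (residual \<eta> \<rho> \<theta> x) = sup_norm X k p (residual \<eta> \<rho> \<theta>)}"
    if opt: "Tp_optimal X k p \<Theta> \<eta> \<rho> \<xi>" and best: "best_param k p \<Theta> \<eta> \<rho> \<xi> \<theta>" for \<xi> \<theta>
  proof -
    have \<xi>: "\<xi> \<in> designs X" "finite (set_pmf \<xi>)" "set_pmf \<xi> \<subseteq> X" and \<theta>: "\<theta> \<in> ?\<Theta>"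
      using opt best by (auto simp: Tp_optimal_def designs_def best_param_def)
    have upper: "psi k p \<eta> \<rho> x \<theta> \<le> ?T \<xi>" if "x \<in> X" for x
      using psi_le_T_crit_optimal[OF opt best _ _ min_attained cont that] A2 level opt by blast
    obtain m where m: "m \<in> X"
        "vec_norm k p (residual \<eta> \<rho> \<theta> m) = sup_norm X k p (residual \<eta> \<rho> \<theta>)"
      using sup_norm_attained[OF compact_X X cont_psi[OF \<theta>]] by blast
    \<comment> \<open>The upper bound at the maximum point \<open>m\<close> closes the gap left by
      weak duality.\<close>
    have S: "?S \<theta> = ?T \<xi>"
      using upper[OF m(1)] lower[OF \<xi>(1) \<theta>] by (simp add: psi_eq_vec_norm m(2))
    have "?T \<xi> \<in> ?S ` ?\<Theta>"
      using imageI[OF \<theta>, of ?S] by (simp only: S)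
    then have "(INF \<theta>\<in>?\<Theta>. ?S \<theta>) = ?T \<xi>"
      by (rule cInf_eq_minimum) (use lower \<xi>(1) in auto)
    moreover have "vec_norm k p (residual \<eta> \<rho> \<theta> x) = sup_norm X k p (residual \<eta> \<rho> \<theta>)"
      if x: "x \<in> set_pmf \<xi>" for x
    proof -
      \<comment> \<open>\<open>?T \<xi>\<close> is both the average of \<open>psi\<close> under
        \<xi> and an upper bound for it.\<close>
      have "psi k p \<eta> \<rho> x \<theta> = ?T \<xi>"
        by (rule expectation_eq_bound_imp_eq[OF \<xi>(2) _ T_crit_eq_expectation_psi[OF \<xi>(2) best, symmetric] x])
           (use upper \<xi>(3) in blast)
      also have "\<dots> = psi k p \<eta> \<rho> m \<theta>"
        using S m(2) by (simp add: psi_eq_vec_norm)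
      finally show ?thesis
        unfolding m(2)[symmetric] vec_norm_eq_psi by simp
    qed
    ultimately show ?thesis
      using S \<xi>(3) by blast
  qed
  obtain \<xi> where opt: "Tp_optimal X k p \<Theta> \<eta> \<rho> \<xi>"
    using A2_existence by blast
  then obtain \<theta> where best: "best_param k p \<Theta> \<eta> \<rho> \<xi> \<theta>"
    using A2 by blast
  have "(SUP \<xi>\<in>designs X. ?T \<xi>) = ?T \<xi>"
    by (rule cSup_eq_maximum) (use opt in \<open>auto simp: Tp_optimal_def\<close>)
  then have minimax: "(SUP \<xi>\<in>designs X. ?T \<xi>) = (INF \<theta>\<in>?\<Theta>. ?S \<theta>)"
    using saddle[OF opt best] by simp
  \<comment> \<open>Attained minima turn the inner infimum into the criterion at every design,
    optimal or not.\<close>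
  have "(SUP \<xi>\<in>designs X. INF \<theta>\<in>?\<Theta>. ?E \<xi> \<theta>) = (SUP \<xi>\<in>designs X. ?T \<xi>)"
  proof (rule SUP_cong[OF refl])
    fix \<xi> assume \<xi>: "\<xi> \<in> designs X"
    then obtain \<theta> where "best_param k p \<Theta> \<eta> \<rho> \<xi> \<theta>"
      using best_param_exists[OF bspec[OF min_attained \<xi>]] by blast
    then show "(INF \<theta>\<in>?\<Theta>. ?E \<xi> \<theta>) = ?T \<xi>"
      using \<xi> by (intro INF_expectation_psi) (auto simp: designs_def)
  qed
  moreover have "(INF \<theta>\<in>?\<Theta>. SUP \<xi>\<in>designs X. ?E \<xi> \<theta>) = (INF \<theta>\<in>?\<Theta>. ?S \<theta>)"
    by (rule INF_cong[OF refl]) (rule SUP_expectation_psi[OF compact_X X cont_psi])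
  ultimately show ?thesis
    using minimax saddle by (intro conjI allI impI) (simp_all)
qed

end
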